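(* Let $\Lambda$ be a canonical $\mathcal{R}$-cross-section of $\mathfrak{B}_n$. Below, pairs $(i,j)$ range over $1\le i<j\le n-2$. (i) If $n\ge 8$ is even, then: - $\alpha_{1,2}^{(l)}=\alpha_{i,j}^{(l)}$ for all $(i,j)\in\mathfrak{A}_n$ and all $l=1,\dots,\frac{n-j}{2}$; - $\alpha_{2,3}^{(l)}=\alpha_{i,j}^{(l)}$ for all $(i,j)\notin\mathfrak{A}_n$ and all $l=1,\dots,\lfloor\frac{n-j}{2}\rfloor$; - $\alpha_{1,2}^{(l)}\alpha_{2,3}^{(l+1)}=\alpha_{2,3}^{(l)}\alpha_{1,2}^{(l+1)}$ for all $l=1,\dots,\frac{n}{2}-3$. (ii) If $n\ge 7$ is odd, then: - $\alpha_{2,3}^{(l)}=\alpha_{i,j}^{(l)}$ for all $(i,j)\in\mathfrak{A}_n$ and all $l=1,\dots,\frac{n-j}{2}$; - $\alpha_{1,2}^{(l)}=\alpha_{i,j}^{(l)}$ for all $(i,j)\notin\mathfrak{A}_n$ and all $l=1,\dots,\lfloor\frac{n-j}{2}\rfloor$; - $\alpha_{1,2}^{(l)}\alpha_{2,3}^{(l+1)}=\alpha_{2,3}^{(l)}\alpha_{1,2}^{(l+1)}$ for all $l=1,\dots,\frac{n+1}{2}-3$.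
   Context: Let $M=\{1,\dots,n\}$, $M'=\{1',\dots,n'\}$. The Brauer semigroup $\mathfrak{B}_n$ is the set of all partitions of $M\cup M'$ into two-element subsets; write $a\equiv_\alpha b$ if $\{a,b\}\in\alpha$. The product $\alpha\beta$ is obtained by drawing $\alpha$ to the left of $\beta$ ($M$ = left pins, $M'$ = right pins), identifying each right pin $a'$ of $\alpha$ with the left pin $a$ of $\beta$, pairing the left pins of $\alpha$ and right pins of $\beta$ that are joined by a path, and discarding closed loops. $\mathfrak{B}_n$ is a monoid. $\mathrm{corank}(\alpha)$ is $n$ minus the number of blocks of the form $\{a,b'\}$, $a,b\in M$; it is even. Green's relation: $\alpha\mathcal{R}\beta$ iff $\alpha,\beta$ contain the same two-element subsets of $M$. An $\mathcal{R}$-cross-section is a subsemigroup containing exactly one element of each $\mathcal{R}$-class. An $\mathcal{R}$-cross-section $\Lambda$ is canonical if every $\alpha\in\Lambda$ of corank $2k$ satisfies $(n-2k+1)'\equiv_\alpha(n-2k+2)'$, $(n-2k+3)'\equiv_\alpha(n-2k+4)'$, ..., $(n-1)'\equiv_\alpha n'$. For a canonical $\Lambda$ and $1\le i<j\le n$, $\alpha_{i,j}$ denotes the unique element of $\Lambda$ of corank $2$ with $i\equiv_{\alpha_{i,j}}j$. For $1\le i<j<n-1$ and $l=1,\dots,\lfloor\frac{n-j}{2}\rfloor$, define $\alpha_{i,j}^{(l)}\in\mathcal{S}_2$ to be $\mathrm{id}$ if $(n-2l+2)\equiv_{\alpha_{i,j}}(n-2l)'$ and $(1,2)$ if $(n-2l+2)\equiv_{\alpha_{i,j}}(n-2l-1)'$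 (exactly one of the two always holds). $\mathfrak{A}_n$ is the set of all pairs $(n-3,n-2),(n-5,n-4),\dots$ with positive entries. *)

theory Defs
  imports Main "HOL-Library.Disjoint_Sets" "HOL-Combinatorics.Transposition"
begin

text \<open>A pin \<open>L a\<close> is the element \<open>a\<close> of \<open>M\<close>, and \<open>R a\<close> is the element \<open>a'\<close> of \<open>M'\<close>.\<close>

datatype pin = L nat | R nat

definition pins :: "nat \<Rightarrow> pin set" where
  "pins n = L ` {1..n} \<union> R ` {1..n}"

definition brauer :: "nat \<Rightarrow> pin set set set" where
  "brauer n = {\<alpha>. partition_on (pins n) \<alpha> \<and> (\<forall>X\<in>\<alpha>. card X = 2)}"

abbreviation linked :: "pin set set \<Rightarrow> pin \<Rightarrow> pin \<Rightarrow> bool" where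
  "linked \<alpha> x y \<equiv> {x, y} \<in> \<alpha>"

text \<open>
  The diagram of \<open>\<alpha>\<beta>\<close> has three columns of vertices: the left pins of \<open>\<alpha>\<close>, the right pins of
  \<open>\<alpha>\<close> identified with the left pins of \<open>\<beta>\<close>, and the right pins of \<open>\<beta>\<close>.
\<close>

datatype vertex = Lft nat | Mid nat | Rgt nat

primrec fst_emb :: "pin \<Rightarrow> vertex" where
  "fst_emb (L a) = Lft a"
| "fst_emb (R a) = Mid a"

primrec snd_emb :: "pin \<Rightarrow> vertex" where
  "snd_emb (L a) = Mid a"
| "snd_emb (R a) = Rgt a"

primrec outer_emb :: "pin \<Rightarrow> vertex" where
  "outer_emb (L a) = Lft a"
| "outer_emb (R a) = Rgt a"

definition diagram_edges :: "pin set set \<Rightarrow> pin set set \<Rightarrow> (vertex \<times> vertex) set" where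
  "diagram_edges \<alpha> \<beta> =
     {(fst_emb x, fst_emb y) | x y. linked \<alpha> x y} \<union> {(snd_emb x, snd_emb y) | x y. linked \<beta> x y}"

definition brauer_mult :: "nat \<Rightarrow> pin set set \<Rightarrow> pin set set \<Rightarrow> pin set set" where
  "brauer_mult n \<alpha> \<beta> =
     {{x, y} | x y. x \<in> pins n \<and> y \<in> pins n \<and> x \<noteq> y \<and>
        (outer_emb x, outer_emb y) \<in> (diagram_edges \<alpha> \<beta>)\<^sup>*}"

definition corank :: "nat \<Rightarrow> pin set set \<Rightarrow> nat" where
  "corank n \<alpha> = n - card {X \<in> \<alpha>. \<exists>a b. X = {L a, R b}}"

definition green_R :: "nat \<Rightarrow> (pin set set \<times> pin set set) set" where
  "green_R n = {(\<alpha>, \<beta>). \<alpha> \<in> brauer n \<and> \<beta> \<in> brauer n \<and>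
     {X \<in> \<alpha>. X \<subseteq> range L} = {X \<in> \<beta>. X \<subseteq> range L}}"

definition R_cross_section :: "nat \<Rightarrow> pin set set set \<Rightarrow> bool" where
  "R_cross_section n \<Lambda> \<longleftrightarrow>
     \<Lambda> \<subseteq> brauer n \<and>
     (\<forall>\<alpha>\<in>\<Lambda>. \<forall>\<beta>\<in>\<Lambda>. brauer_mult n \<alpha> \<beta> \<in> \<Lambda>) \<and>
     (\<forall>C \<in> brauer n // green_R n. \<exists>!\<alpha>. \<alpha> \<in> \<Lambda> \<and> \<alpha> \<in> C)"

definition canonical :: "nat \<Rightarrow> pin set set set \<Rightarrow> bool" where
  "canonical n \<Lambda> \<longleftrightarrow>
     (\<forall>\<alpha>\<in>\<Lambda>. \<forall>k. corank n \<alpha> = 2 * k \<longrightarrow>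
        (\<forall>t\<in>{1..k}. linked \<alpha> (R (n - 2 * t + 1)) (R (n - 2 * t + 2))))"

definition alpha :: "nat \<Rightarrow> pin set set set \<Rightarrow> nat \<Rightarrow> nat \<Rightarrow> pin set set" where
  "alpha n \<Lambda> i j = (THE \<alpha>. \<alpha> \<in> \<Lambda> \<and> corank n \<alpha> = 2 \<and> linked \<alpha> (L i) (L j))"

text \<open>
  The element of the symmetric group on two letters is a permutation of \<open>nat\<close> that fixes all
  points other than 1 and 2. The value is meant only for \<open>1 \<le> i < j < n - 1\<close> and
  \<open>1 \<le> l \<le> (n - j) div 2\<close>, where no subtraction below truncates; for a canonical
  \<open>\<R>\<close>-cross-section exactly one of the two conditions then holds.
\<close>

definition alpha_perm :: "nat \<Rightarrow> pin set set set \<Rightarrow> nat \<Rightarrow> nat \<Rightarrow> nat \<Rightarrow> (nat \<Rightarrow> nat)" where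
  "alpha_perm n \<Lambda> i j l =
     (if linked (alpha n \<Lambda> i j) (L (n - 2 * l + 2)) (R (n - 2 * l)) then id
      else if linked (alpha n \<Lambda> i j) (L (n - 2 * l + 2)) (R (n - 2 * l - 1)) then transpose 1 2
      else undefined)"

definition A_pairs :: "nat \<Rightarrow> (nat \<times> nat) set" where
  "A_pairs n = {(n - 2 * m - 1, n - 2 * m) | m. 1 \<le> m \<and> 2 * m + 1 < n}"

end

theory Submission
  imports Defs
begin

text \<open>
  Write \<open>f\<^bsub>i,j\<^esub>\<close> for the map from left to right pins given by the through blocks of
  \<open>\<alpha>\<^bsub>i,j\<^esub>\<close>, and \<open>B\<^sub>s = {n - 2s + 1, n - 2s + 2}\<close>. Let \<open>\<gamma> \<in> \<Lambda>\<close> have corank \<open>2t\<close>.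
  If \<open>j > n - 2t\<close>, then \<open>\<gamma>\<alpha>\<^bsub>i,j\<^esub>\<close> is \<open>\<R>\<close>-related to \<open>\<gamma>\<close>, hence equal to it, and
  \<open>f\<^bsub>i,j\<^esub>\<close> is determined on the pins up to \<open>n - 2t\<close>. If \<open>i, j \<le> n - 2t\<close>, then \<open>\<gamma>\<alpha>\<^bsub>i,j\<^esub>\<close>
  has corank \<open>2t + 2\<close>, and canonicity forces \<open>f\<^bsub>i,j\<^esub>(B\<^sub>t) = B\<^bsub>t+1\<^esub>\<close>. So \<open>\<alpha>\<^bsub>i,j\<^esub>\<close> is
  known up to the orientations with which \<open>f\<^bsub>i,j\<^esub>\<close> maps \<open>B\<^sub>l\<close> to \<open>B\<^bsub>l+1\<^esub>\<close>.

  For distinct \<open>i, j, k, l\<close> the products \<open>\<alpha>\<^bsub>i,j\<^esub>\<alpha>\<^bsub>f(k),f(l)\<^esub>\<close> with \<open>f = f\<^bsub>i,j\<^esub>\<close>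
  and \<open>\<alpha>\<^bsub>k,l\<^esub>\<alpha>\<^bsub>g(i),g(j)\<^esub>\<close> with \<open>g = f\<^bsub>k,l\<^esub>\<close> have the same left blocks, so they
  agree. Taking \<open>{k,l}\<close> or both pairs to be some \<open>B\<^sub>s\<close> shows that the orientations for
  \<open>{i,j} = B\<^sub>s\<close> depend only on the level, and that all other \<open>{i,j}\<close> differ from them by a sign
  independent of the level. Taking \<open>{i,j} = B\<^bsub>s+1\<^esub>\<close> and \<open>l \<in> B\<^sub>s\<close> transports this sign from
  larger \<open>s\<close> to \<open>s = 2\<close>, where at least three pins below \<open>B\<^sub>2\<close> force it to be constant.

  All products involved lie in \<open>\<Lambda>\<close>, hence are perfect matchings; exhibiting a path for each
  claimed block thus suffices to compute them.
\<close>

section \<open>Brauer diagrams as perfect matchings, and their corank\<close>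

lemma linked_sym: "linked \<alpha> x y \<longleftrightarrow> linked \<alpha> y x"
  by (simp add: insert_commute)

context
  fixes n :: nat and \<alpha> :: "pin set set"
  assumes \<alpha>: "\<alpha> \<in> brauer n"
begin

lemma brauer_partition: "partition_on (pins n) \<alpha>"
  using \<alpha> by (simp add: brauer_def)

lemma linked_neq: "linked \<alpha> x y \<Longrightarrow> x \<noteq> y"
  using \<alpha> by (force simp: brauer_def)

lemma linked_pins:
  assumes "linked \<alpha> x y"
  shows "x \<in> pins n" "y \<in> pins n"
  using partition_onD1[OF brauer_partition] assms by auto

lemma linked_unique:
  assumes "linked \<alpha> x y" "linked \<alpha> x z"
  shows "y = z"
proof -
  have "{x, y} = {x, z}"
    using disjointD[OF partition_onD2[OF brauer_partition] assms] by auto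
  then show ?thesis
    using linked_neq[OF assms(1)] by (auto simp: doubleton_eq_iff)
qed

lemma linked_ex:
  assumes "x \<in> pins n"
  shows "\<exists>y. linked \<alpha> x y"
proof -
  obtain X where X: "X \<in> \<alpha>" "x \<in> X"
    using partition_onD1[OF brauer_partition] assms by auto
  then have "card X = 2" using \<alpha> by (auto simp: brauer_def)
  then obtain u v where "X = {u, v}" by (auto simp: card_2_iff)
  with X show ?thesis by (auto simp: insert_commute)
qed

lemma linked_left_cases:
  assumes "a \<in> {1..n}"
  obtains b where "b \<in> {1..n}" "linked \<alpha> (L a) (L b)"
  | b where "b \<in> {1..n}" "linked \<alpha> (L a) (R b)"
proof -
  have "L a \<in> pins n" using assms by (auto simp: pins_def)
  then obtain y where y: "linked \<alpha> (L a) y" using linked_ex by blast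
  with linked_pins(2)[OF y] show ?thesis using that by (auto simp: pins_def)
qed

lemma linked_left_right_disjoint: "linked \<alpha> (L a) (L b) \<Longrightarrow> \<not> linked \<alpha> (L a) (R c)"
  using linked_unique by blast

text \<open>Every left pin lies either in a left block or in a through block, and through blocks are
  counted by either of their ends.\<close>

lemma corank_eq_card_left:
  "corank n \<alpha> = card {a \<in> {1..n}. \<exists>b. linked \<alpha> (L a) (L b)}"
  and card_through_right:
  "card {b \<in> {1..n}. \<exists>a. linked \<alpha> (L a) (R b)} = n - corank n \<alpha>"
proof -
  define T where "T = {a \<in> {1..n}. \<exists>b. linked \<alpha> (L a) (R b)}"
  define S where "S = {a \<in> {1..n}. \<exists>b. linked \<alpha> (L a) (L b)}"
  obtain g where g: "\<forall>a\<in>T. linked \<alpha> (L a) (R (g a))"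
    using bchoice[of T "\<lambda>a b. linked \<alpha> (L a) (R b)"] by (auto simp: T_def)
  have T1: "a \<in> T" if "linked \<alpha> (L a) (R b)" for a b
    using that linked_pins(1)[OF that] by (auto simp: T_def pins_def)
  have gb: "b = g a" if "linked \<alpha> (L a) (R b)" for a b
    using g T1[OF that] linked_unique[OF that] by blast
  have "{X \<in> \<alpha>. \<exists>a b. X = {L a, R b}} = (\<lambda>a. {L a, R (g a)}) ` T"
    using g T1 gb by auto
  moreover have "inj_on (\<lambda>a. {L a, R (g a)}) T"
    by (auto simp: inj_on_def doubleton_eq_iff)
  ultimately have *: "card {X \<in> \<alpha>. \<exists>a b. X = {L a, R b}} = card T"
    by (simp add: card_image)
  have ST: "S \<inter> T = {}" "S \<union> T = {1..n}"
    using linked_left_right_disjoint linked_left_cases by (auto simp: S_def T_def) blast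
  have "card S + card T = n"
    using card_Un_disjoint[of S T] ST by (simp add: S_def T_def)
  with * show 1: "corank n \<alpha> = card S" by (simp add: corank_def)
  have "inj_on g T"
    by (rule inj_onI) (metis g linked_sym linked_unique pin.inject(1))
  moreover have "{b \<in> {1..n}. \<exists>a. linked \<alpha> (L a) (R b)} = g ` T"
  proof -
    have "b \<in> {1..n}" if "linked \<alpha> (L a) (R b)" for a b
      using linked_pins(2)[OF that] by (auto simp: pins_def)
    then show ?thesis using g T1 gb by blast
  qed
  ultimately have "card {b \<in> {1..n}. \<exists>a. linked \<alpha> (L a) (R b)} = card T"
    by (simp add: card_image)
  with \<open>card S + card T = n\<close> 1
  show "card {b \<in> {1..n}. \<exists>a. linked \<alpha> (L a) (R b)} = n - corank n \<alpha>" by simp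
qed

end

section \<open>Paths in the diagram of a product\<close>

context
  fixes n :: nat and \<alpha> \<beta> :: "pin set set"
  assumes \<alpha>: "\<alpha> \<in> brauer n" and \<beta>: "\<beta> \<in> brauer n"
begin

lemma path_fst: "linked \<alpha> x y \<Longrightarrow> (fst_emb x, fst_emb y) \<in> (diagram_edges \<alpha> \<beta>)\<^sup>*"
  and path_snd: "linked \<beta> x y \<Longrightarrow> (snd_emb x, snd_emb y) \<in> (diagram_edges \<alpha> \<beta>)\<^sup>*"
  unfolding diagram_edges_def by blast+

lemma linked_multI:
  assumes "(outer_emb x, outer_emb y) \<in> (diagram_edges \<alpha> \<beta>)\<^sup>*" "x \<in> pins n" "y \<in> pins n" "x \<noteq> y"
  shows "linked (brauer_mult n \<alpha> \<beta>) x y"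
  using assms unfolding brauer_mult_def by blast

lemma linked_mult_left:
  assumes "linked \<alpha> (L a) (L b)"
  shows "linked (brauer_mult n \<alpha> \<beta>) (L a) (L b)"
  using path_fst[OF assms] linked_pins[OF \<alpha> assms] linked_neq[OF \<alpha> assms]
  by (intro linked_multI) auto

lemma linked_mult_through:
  assumes "linked \<alpha> (L a) (R c)" "linked \<beta> (L c) (R d)"
  shows "linked (brauer_mult n \<alpha> \<beta>) (L a) (R d)"
proof (rule linked_multI)
  show "(outer_emb (L a), outer_emb (R d)) \<in> (diagram_edges \<alpha> \<beta>)\<^sup>*"
    using path_fst[OF assms(1)] path_snd[OF assms(2)]
    by simp
qed (use linked_pins[OF \<alpha> assms(1)] linked_pins[OF \<beta> assms(2)] in auto)

lemma linked_mult_pull_left: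
  assumes "linked \<alpha> (L a) (R c)" "linked \<beta> (L c) (L c')" "linked \<alpha> (L a') (R c')"
  shows "linked (brauer_mult n \<alpha> \<beta>) (L a) (L a')"
proof (rule linked_multI)
  have "linked \<alpha> (R c') (L a')" using assms(3) linked_sym by blast
  then show "(outer_emb (L a), outer_emb (L a')) \<in> (diagram_edges \<alpha> \<beta>)\<^sup>*"
    using path_fst[OF assms(1)] path_snd[OF assms(2)]
      path_fst[of "R c'" "L a'"]
    by simp
  have "c \<noteq> c'" using linked_neq[OF \<beta> assms(2)] by auto
  then show "L a \<noteq> L a'" using linked_unique[OF \<alpha> assms(1)] assms(3) by auto
qed (use linked_pins[OF \<alpha> assms(1)] linked_pins[OF \<alpha> assms(3)] in auto)

lemma linked_mult_push_right:
  assumes "linked \<beta> (L c) (R d)" "linked \<alpha> (R c) (R c')" "linked \<beta> (L c') (R d')"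
  shows "linked (brauer_mult n \<alpha> \<beta>) (R d) (R d')"
proof (rule linked_multI)
  have d: "linked \<beta> (R d) (L c)" "linked \<beta> (R d') (L c')" using assms linked_sym by blast+
  then show "(outer_emb (R d), outer_emb (R d')) \<in> (diagram_edges \<alpha> \<beta>)\<^sup>*"
    using path_snd[OF d(1)] path_fst[OF assms(2)] path_snd[OF assms(3)]
    by simp
  have "c \<noteq> c'" using linked_neq[OF \<alpha> assms(2)] by auto
  then show "R d \<noteq> R d'" using linked_unique[OF \<beta> d(1)] d(2) by auto
qed (use linked_pins[OF \<beta> assms(1)] linked_pins[OF \<beta> assms(3)] in auto)

text \<open>The path passes through \<alpha>, turns back at a left block of \<beta>, turns again at
  a right block of \<alpha> and leaves through \<beta>.\<close>

lemma linked_mult_detour: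
  assumes "linked \<alpha> (L a) (R c)" "linked \<beta> (L c) (L c')" "linked \<alpha> (R c') (R c'')"
    "linked \<beta> (L c'') (R d)"
  shows "linked (brauer_mult n \<alpha> \<beta>) (L a) (R d)"
proof (rule linked_multI)
  show "(outer_emb (L a), outer_emb (R d)) \<in> (diagram_edges \<alpha> \<beta>)\<^sup>*"
    using path_fst[OF assms(1)] path_snd[OF assms(2)]
      path_fst[OF assms(3)] path_snd[OF assms(4)]
    by simp
qed (use linked_pins[OF \<alpha> assms(1)] linked_pins[OF \<beta> assms(4)] in auto)

end

section \<open>Canonical cross-sections and their elements of corank 2\<close>

locale canonical_cross_section =
  fixes n :: nat and \<Lambda> :: "pin set set set"
  assumes cross_section: "R_cross_section n \<Lambda>" and canonical: "canonical n \<Lambda>"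
begin

lemma \<Lambda>_brauer: "\<alpha> \<in> \<Lambda> \<Longrightarrow> \<alpha> \<in> brauer n"
  using cross_section by (auto simp: R_cross_section_def)

lemma \<Lambda>_mult: "\<alpha> \<in> \<Lambda> \<Longrightarrow> \<beta> \<in> \<Lambda> \<Longrightarrow> brauer_mult n \<alpha> \<beta> \<in> \<Lambda>"
  using cross_section by (auto simp: R_cross_section_def)

lemma \<Lambda>_ex1_class: "\<alpha> \<in> brauer n \<Longrightarrow> \<exists>!\<beta>. \<beta> \<in> \<Lambda> \<and> (\<alpha>, \<beta>) \<in> green_R n"
  using cross_section quotientI[of \<alpha> "brauer n" "green_R n"]
  unfolding R_cross_section_def Image_singleton_iff[symmetric] by blast

text \<open>A pin in a through block lies in no left block, so the hypothesis forces equal left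
  blocks, and an \<R>-class meets \<open>\<Lambda>\<close> only once. Only the existence of links is
  asked for, so exhibited paths suffice to verify it.\<close>

lemma \<Lambda>_eqI:
  assumes "\<alpha> \<in> \<Lambda>" "\<beta> \<in> \<Lambda>"
    and *: "\<And>a. a \<in> {1..n} \<Longrightarrow> (\<exists>b. linked \<alpha> (L a) (L b) \<and> linked \<beta> (L a) (L b)) \<or>
      ((\<exists>c. linked \<alpha> (L a) (R c)) \<and> (\<exists>d. linked \<beta> (L a) (R d)))"
  shows "\<alpha> = \<beta>"
proof -
  note b = \<Lambda>_brauer[OF assms(1)] \<Lambda>_brauer[OF assms(2)]
  have "linked \<alpha> (L a) (L b) \<longleftrightarrow> linked \<beta> (L a) (L b)" for a b
  proof (cases "a \<in> {1..n}")
    case True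
    from *[OF True] show ?thesis
    proof (elim disjE exE conjE)
      fix c assume "linked \<alpha> (L a) (L c)" "linked \<beta> (L a) (L c)"
      then show ?thesis
        using linked_unique[OF b(1), of "L a" "L c" "L b"]
          linked_unique[OF b(2), of "L a" "L c" "L b"] by auto
    next
      fix c d assume "linked \<alpha> (L a) (R c)" "linked \<beta> (L a) (R d)"
      then show ?thesis
        using linked_unique[OF b(1), of "L a" "R c" "L b"]
          linked_unique[OF b(2), of "L a" "R d" "L b"] by auto
    qed
  next
    case False
    then have "L a \<notin> pins n" by (auto simp: pins_def)
    then show ?thesis
      using linked_pins(1)[OF b(1), of "L a" "L b"] linked_pins(1)[OF b(2), of "L a" "L b"] by auto
  qed
  moreover have "\<exists>a b. X = {L a, L b}" if "X \<in> \<alpha> \<union> \<beta>" "X \<subseteq> range L" for X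
  proof -
    have "card X = 2" using that b by (auto simp: brauer_def)
    then obtain x y where "X = {x, y}" by (auto simp: card_2_iff)
    with that(2) show ?thesis by auto
  qed
  ultimately have "X \<in> \<alpha> \<longleftrightarrow> X \<in> \<beta>" if "X \<subseteq> range L" for X
    using that by (metis UnI1 UnI2)
  then have "(\<alpha>, \<beta>) \<in> green_R n"
    using b by (auto simp: green_R_def)
  moreover have "(\<alpha>, \<alpha>) \<in> green_R n" using b by (auto simp: green_R_def)
  ultimately show ?thesis using \<Lambda>_ex1_class[OF b(1)] assms(1,2) by (metis (no_types, lifting))
qed

lemma alpha_ex:
  assumes ij: "i \<in> {1..n}" "j \<in> {1..n}" "i \<noteq> j"
  shows "\<exists>\<alpha>\<in>\<Lambda>. corank n \<alpha> = 2 \<and> linked \<alpha> (L i) (L j)"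
proof -
  \<comment> \<open>The identity diagram with the strands at \<open>i\<close> and \<open>j\<close>
    replaced by a left and a right block; \<open>\<Lambda>\<close> contains an element with the same
    left blocks.\<close>
  define \<eta> where "\<eta> = {{L i, L j}, {R i, R j}} \<union> (\<lambda>x. {L x, R x}) ` ({1..n} - {i, j})"
  have "partition_on (pins n) \<eta>"
  proof (rule partition_onI)
    show "\<Union>\<eta> = pins n" using ij by (auto simp: \<eta>_def pins_def)
    show "disjnt p q" if "p \<in> \<eta>" "q \<in> \<eta>" "p \<noteq> q" for p q
      using that by (auto simp: \<eta>_def disjnt_def)
  qed (auto simp: \<eta>_def)
  then have \<eta>: "\<eta> \<in> brauer n"
    using ij by (auto simp: brauer_def \<eta>_def)
  then obtain \<alpha> where \<alpha>: "\<alpha> \<in> \<Lambda>" "(\<eta>, \<alpha>) \<in> green_R n" using \<Lambda>_ex1_class by blast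
  have l: "linked \<alpha> (L a) (L b) \<longleftrightarrow> {a, b} = {i, j}" for a b
  proof -
    have "{L a, L b} \<subseteq> range L" by auto
    then have "linked \<alpha> (L a) (L b) \<longleftrightarrow> linked \<eta> (L a) (L b)"
      using \<alpha>(2) unfolding green_R_def by blast
    also have "\<dots> \<longleftrightarrow> {a, b} = {i, j}"
      by (auto simp: \<eta>_def doubleton_eq_iff)
    finally show ?thesis .
  qed
  have "{a \<in> {1..n}. \<exists>b. linked \<alpha> (L a) (L b)} = {i, j}"
    using ij unfolding l by (auto simp: doubleton_eq_iff)
  then have "corank n \<alpha> = 2"
    using corank_eq_card_left[OF \<Lambda>_brauer[OF \<alpha>(1)]] ij by simp
  then show ?thesis using \<alpha>(1) l by blast
qed

text \<open>Corank 2 leaves room for a single left block, so all left blocks are prescribed. This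
  makes the \<open>THE\<close> in \<open>alpha\<close> meaningful.\<close>

lemma alpha_ex1:
  assumes ij: "i \<in> {1..n}" "j \<in> {1..n}" "i \<noteq> j"
  shows "\<exists>!\<alpha>. \<alpha> \<in> \<Lambda> \<and> corank n \<alpha> = 2 \<and> linked \<alpha> (L i) (L j)"
proof -
  have left: "(\<exists>b. linked \<alpha> (L a) (L b)) \<longleftrightarrow> a = i \<or> a = j"
    if \<alpha>: "\<alpha> \<in> \<Lambda>" "corank n \<alpha> = 2" "linked \<alpha> (L i) (L j)" and a: "a \<in> {1..n}" for \<alpha> a
  proof -
    have "{i, j} \<subseteq> {a \<in> {1..n}. \<exists>b. linked \<alpha> (L a) (L b)}"
      using ij \<alpha>(3) linked_sym by auto
    moreover have "card {a \<in> {1..n}. \<exists>b. linked \<alpha> (L a) (L b)} = card {i, j}"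
      using corank_eq_card_left[OF \<Lambda>_brauer[OF \<alpha>(1)]] \<alpha>(2) ij by simp
    ultimately have "{i, j} = {a \<in> {1..n}. \<exists>b. linked \<alpha> (L a) (L b)}"
      by (intro card_subset_eq) auto
    then show ?thesis using a by auto
  qed
  have "\<alpha> = \<beta>"
    if \<alpha>: "\<alpha> \<in> \<Lambda>" "corank n \<alpha> = 2" "linked \<alpha> (L i) (L j)"
      and \<beta>: "\<beta> \<in> \<Lambda>" "corank n \<beta> = 2" "linked \<beta> (L i) (L j)" for \<alpha> \<beta>
  proof (rule \<Lambda>_eqI[OF \<alpha>(1) \<beta>(1)])
    fix a assume a: "a \<in> {1..n}"
    consider "a = i" | "a = j" | "\<nexists>b. linked \<alpha> (L a) (L b)" "\<nexists>b. linked \<beta> (L a) (L b)"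
      using left[OF \<alpha> a] left[OF \<beta> a] by blast
    then show "(\<exists>b. linked \<alpha> (L a) (L b) \<and> linked \<beta> (L a) (L b)) \<or>
      ((\<exists>c. linked \<alpha> (L a) (R c)) \<and> (\<exists>d. linked \<beta> (L a) (R d)))"
    proof cases
      case 3
      then show ?thesis
        using linked_left_cases[OF \<Lambda>_brauer[OF \<alpha>(1)] a]
          linked_left_cases[OF \<Lambda>_brauer[OF \<beta>(1)] a] by metis
    qed (use \<alpha>(3) \<beta>(3) linked_sym in blast)+
  qed
  then show ?thesis using alpha_ex[OF ij] by blast
qed

abbreviation A :: "nat \<Rightarrow> nat \<Rightarrow> pin set set" where
  "A \<equiv> alpha n \<Lambda>"

lemma A_commute: "A i j = A j i"
  by (simp add: alpha_def insert_commute)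

text \<open>The map \<open>f\<close> of the overview; its values carry meaning only on pins in
  \<open>{1..n}\<close> other than \<open>i\<close> and \<open>j\<close>.\<close>

definition target :: "nat \<Rightarrow> nat \<Rightarrow> nat \<Rightarrow> nat" where
  "target i j x = (THE y. linked (A i j) (L x) (R y))"

lemma target_commute: "target i j = target j i"
  by (simp add: target_def A_commute fun_eq_iff)

context
  fixes i j :: nat
  assumes ij: "i \<in> {1..n}" "j \<in> {1..n}" "i \<noteq> j"
begin

lemma A_in: "A i j \<in> \<Lambda>"
  and A_corank: "corank n (A i j) = 2"
  and A_linked: "linked (A i j) (L i) (L j)"
  using theI'[OF alpha_ex1[OF ij]] by (simp_all add: alpha_def)

lemmas A_brauer = \<Lambda>_brauer[OF A_in]

lemma target_eqI: "linked (A i j) (L x) (R y) \<Longrightarrow> target i j x = y"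
  unfolding target_def using linked_unique[OF A_brauer] by blast

lemma target_linked:
  assumes "x \<in> {1..n}" "x \<noteq> i" "x \<noteq> j"
  shows "linked (A i j) (L x) (R (target i j x))"
proof -
  have "{i, j} \<subseteq> {a \<in> {1..n}. \<exists>b. linked (A i j) (L a) (L b)}"
    using ij A_linked linked_sym by auto
  moreover have "card {a \<in> {1..n}. \<exists>b. linked (A i j) (L a) (L b)} = card {i, j}"
    using corank_eq_card_left[OF A_brauer] A_corank ij by simp
  ultimately have "{i, j} = {a \<in> {1..n}. \<exists>b. linked (A i j) (L a) (L b)}"
    by (intro card_subset_eq) auto
  then have "\<nexists>b. linked (A i j) (L x) (L b)" using assms by auto
  then obtain y where "linked (A i j) (L x) (R y)"
    using linked_left_cases[OF A_brauer assms(1)] by metis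
  then show ?thesis using target_eqI by blast
qed

lemma target_inj:
  assumes "x \<in> {1..n} - {i, j}" "y \<in> {1..n} - {i, j}" "target i j x = target i j y"
  shows "x = y"
proof -
  have "linked (A i j) (R (target i j x)) (L x)" "linked (A i j) (R (target i j x)) (L y)"
    using target_linked[of x] target_linked[of y] assms by (simp_all add: insert_commute)
  then show ?thesis using linked_unique[OF A_brauer] by blast
qed

end

section \<open>Constraints on \<open>target\<close> from canonicity in higher corank\<close>

definition partner :: "nat \<Rightarrow> nat" where
  "partner x = (if even (n - x) then x - 1 else x + 1)"

context
  fixes \<gamma> :: "pin set set" and t :: nat
  assumes \<gamma>: "\<gamma> \<in> \<Lambda>" and corank: "corank n \<gamma> = 2 * t"
begin

lemma double_le: "2 * t \<le> n"
  using corank unfolding corank_def by linarith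

lemma linked_partner:
  assumes "n - 2 * t < x" "x \<le> n"
  shows "linked \<gamma> (R x) (R (partner x))"
proof -
  \<comment> \<open>\<open>s\<close> is the index of the block \<open>B_s\<close> containing
    \<open>x\<close>, and \<open>partner x\<close> is the other pin of \<open>B_s\<close>.\<close>
  define s where "s = (n - x) div 2 + 1"
  have "s \<in> {1..t}" using assms double_le unfolding s_def atLeastAtMost_iff by linarith
  then have l: "linked \<gamma> (R (n - 2 * s + 1)) (R (n - 2 * s + 2))"
    using canonical \<gamma> corank unfolding canonical_def by blast
  show ?thesis
  proof (cases "even (n - x)")
    case True
    then have "2 * s = n - x + 2" by (simp add: s_def)
    then have "x = n - 2 * s + 2" "partner x = n - 2 * s + 1"
      using assms double_le True \<open>s \<in> {1..t}\<close> by (auto simp: partner_def)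
    then show ?thesis using l by (simp add: insert_commute)
  next
    case False
    then have "2 * s = n - x + 1" unfolding s_def by presburger
    then have "x = n - 2 * s + 1" "partner x = n - 2 * s + 2"
      using assms double_le False \<open>s \<in> {1..t}\<close> by (auto simp: partner_def)
    then show ?thesis using l by simp
  qed
qed

text \<open>The right pins above \<open>n - 2 * t\<close> are used up by canonical right
  blocks.\<close>

lemma through_le:
  assumes "linked \<gamma> (L a) (R c)"
  shows "c \<in> {1..n - 2 * t}"
proof -
  have "c \<in> {1..n}" using linked_pins(2)[OF \<Lambda>_brauer[OF \<gamma>] assms] by (auto simp: pins_def)
  moreover have "\<not> n - 2 * t < c"
  proof
    assume "n - 2 * t < c"
    then have "linked \<gamma> (R c) (R (partner c))" using linked_partner \<open>c \<in> {1..n}\<close> by simp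
    moreover have "linked \<gamma> (R c) (L a)" using assms by (simp add: insert_commute)
    ultimately show False using linked_unique[OF \<Lambda>_brauer[OF \<gamma>]] by blast
  qed
  ultimately show ?thesis by simp
qed

text \<open>There are \<open>n - 2 * t\<close> through blocks, as many as the right pins that
  \<open>through_le\<close> leaves to them.\<close>

lemma through_ex:
  assumes "c \<in> {1..n - 2 * t}"
  obtains a where "a \<in> {1..n}" "linked \<gamma> (L a) (R c)"
proof -
  have "{b \<in> {1..n}. \<exists>a. linked \<gamma> (L a) (R b)} = {1..n - 2 * t}"
    using through_le card_through_right[OF \<Lambda>_brauer[OF \<gamma>]] corank
    by (intro card_subset_eq) auto
  then obtain a where "linked \<gamma> (L a) (R c)" using assms by blast
  with linked_pins(1)[OF \<Lambda>_brauer[OF \<gamma>] this] show ?thesis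
    using that by (auto simp: pins_def)
qed

text \<open>The through blocks of \<gamma> ending at \<open>i\<close> and \<open>j\<close> merge
  into one new left block; all others continue through \<open>A i j\<close>.\<close>

lemma corank_mult_A:
  assumes ij: "i \<in> {1..n - 2 * t}" "j \<in> {1..n - 2 * t}" "i \<noteq> j"
  shows "corank n (brauer_mult n \<gamma> (A i j)) = 2 * (t + 1)"
proof -
  have ij': "i \<in> {1..n}" "j \<in> {1..n}" "i \<noteq> j" using ij by auto
  note b = \<Lambda>_brauer[OF \<gamma>]
  let ?\<pi> = "brauer_mult n \<gamma> (A i j)"
  have \<pi>: "?\<pi> \<in> brauer n" using \<Lambda>_brauer \<Lambda>_mult \<gamma> A_in[OF ij'] by blast
  obtain a where a: "a \<in> {1..n}" "linked \<gamma> (L a) (R i)" using through_ex ij by blast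
  obtain b' where b': "b' \<in> {1..n}" "linked \<gamma> (L b') (R j)" using through_ex ij by blast
  have ab: "linked ?\<pi> (L a) (L b')"
    using linked_mult_pull_left[OF b A_brauer[OF ij'] a(2) A_linked[OF ij'] b'(2)] .
  have neq: "a \<noteq> b'" using linked_unique[OF b a(2)] b'(2) ij by blast
  define S where "S = {a \<in> {1..n}. \<exists>b. linked \<gamma> (L a) (L b)}"
  have S: "a \<notin> S" "b' \<notin> S"
    using linked_left_right_disjoint[OF b] a(2) b'(2) by (auto simp: S_def)
  have "{a \<in> {1..n}. \<exists>b. linked ?\<pi> (L a) (L b)} = insert a (insert b' S)"
  proof (intro equalityI subsetI)
    fix x assume "x \<in> insert a (insert b' S)"
    then show "x \<in> {a \<in> {1..n}. \<exists>b. linked ?\<pi> (L a) (L b)}"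
      using ab a b' linked_mult_left[OF b A_brauer[OF ij']]
      by (auto simp: S_def insert_commute)
  next
    fix x assume x: "x \<in> {a \<in> {1..n}. \<exists>b. linked ?\<pi> (L a) (L b)}"
    show "x \<in> insert a (insert b' S)"
    proof (rule ccontr)
      assume nx: "x \<notin> insert a (insert b' S)"
      then obtain c where c: "c \<in> {1..n}" "linked \<gamma> (L x) (R c)"
        using x linked_left_cases[OF b, of x] by (auto simp: S_def)
      have "c \<noteq> i" "c \<noteq> j"
        using nx c(2) a(2) b'(2) linked_unique[OF b, of "R c" "L x"] by (auto simp: insert_commute)
      then have "linked ?\<pi> (L x) (R (target i j c))"
        using linked_mult_through[OF b A_brauer[OF ij'] c(2) target_linked[OF ij']] c(1) by blast
      then show False using x linked_left_right_disjoint[OF \<pi>] by blast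
    qed
  qed
  moreover have "finite S" "card S = 2 * t"
    using corank_eq_card_left[OF b] corank by (simp_all add: S_def)
  ultimately show ?thesis
    using corank_eq_card_left[OF \<pi>] S neq by simp
qed

text \<open>No through block of \<gamma> is lost in the product: one ending at \<open>i\<close>
  turns at \<open>{i, j}\<close>, then at the right block \<open>{j, partner j}\<close> of \<gamma>,
  and leaves from \<open>partner j\<close>. Hence \<gamma> equals the product, and comparing right
  ends gives both claims.\<close>

lemma
  assumes ij: "i \<in> {1..n}" "j \<in> {1..n}" "i \<noteq> j" and j: "n - 2 * t < j"
  shows target_fixes_aux: "\<And>x. x \<in> {1..n - 2 * t} \<Longrightarrow> x \<noteq> i \<Longrightarrow> target i j x = x"
    and target_partner_aux: "i \<le> n - 2 * t \<Longrightarrow> target i j (partner j) = i"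
proof -
  note b = \<Lambda>_brauer[OF \<gamma>] A_brauer[OF ij]
  let ?\<pi> = "brauer_mult n \<gamma> (A i j)"
  have \<pi>: "?\<pi> \<in> \<Lambda>" using \<Lambda>_mult \<gamma> A_in[OF ij] by blast
  have fix_link: "linked ?\<pi> (L a) (R (target i j c))" if "linked \<gamma> (L a) (R c)" "c \<noteq> i" for a c
    using linked_mult_through[OF b that(1) target_linked[OF ij]] through_le[OF that(1)] that(2) j by force
  have jp: "linked \<gamma> (R j) (R (partner j))" using linked_partner j ij by simp
  have pj: "partner j \<in> {1..n}" "partner j \<noteq> j"
    using linked_pins(2)[OF b(1) jp] linked_neq[OF b(1) jp] by (auto simp: pins_def)
  have pi: "linked ?\<pi> (L a) (R (target i j (partner j)))"
    if "linked \<gamma> (L a) (R i)" for a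
  proof -
    have "partner j \<noteq> i"
    proof
      assume "partner j = i"
      then have "linked \<gamma> (R i) (R j)" "linked \<gamma> (R i) (L a)"
        using jp that by (auto simp: insert_commute)
      then show False using linked_unique[OF b(1)] by blast
    qed
    then show ?thesis
      using linked_mult_detour[OF b that A_linked[OF ij] jp target_linked[OF ij]] pj by blast
  qed
  have "\<gamma> = ?\<pi>"
  proof (rule \<Lambda>_eqI[OF \<gamma> \<pi>])
    fix a assume "a \<in> {1..n}"
    then show "(\<exists>b. linked \<gamma> (L a) (L b) \<and> linked ?\<pi> (L a) (L b)) \<or>
      ((\<exists>c. linked \<gamma> (L a) (R c)) \<and> (\<exists>d. linked ?\<pi> (L a) (R d)))"
      using linked_left_cases[OF b(1)] linked_mult_left[OF b] fix_link pi by metis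
  qed
  then have *: "target i j c = c" if "linked \<gamma> (L a) (R c)" "c \<noteq> i" for a c
    using fix_link[OF that] linked_unique[OF b(1)] that(1) by (metis pin.inject(2))
  show "target i j x = x" if "x \<in> {1..n - 2 * t}" "x \<noteq> i" for x
    using through_ex[OF that(1)] * that(2) by metis
  show "target i j (partner j) = i" if "i \<le> n - 2 * t"
  proof -
    have "i \<in> {1..n - 2 * t}" using that ij by simp
    then obtain a where "linked \<gamma> (L a) (R i)" using through_ex by blast
    then show ?thesis
      using pi \<open>\<gamma> = ?\<pi>\<close> linked_unique[OF b(1)] by (metis pin.inject(2))
  qed
qed

end

text \<open>Multiplication by \<open>A 1 2\<close> raises the corank by 2 as long as at least two
  right pins remain for through blocks.\<close>

lemma corank_ex:
  assumes "1 \<le> t" "2 * t \<le> n"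
  obtains \<gamma> where "\<gamma> \<in> \<Lambda>" "corank n \<gamma> = 2 * t"
proof -
  have "\<exists>\<gamma>\<in>\<Lambda>. corank n \<gamma> = 2 * t"
    using assms
  proof (induction t rule: dec_induct)
    case base
    then show ?case using alpha_ex[of 1 2] by auto
  next
    case (step t)
    then obtain \<gamma> where \<gamma>: "\<gamma> \<in> \<Lambda>" "corank n \<gamma> = 2 * t" by auto
    have "corank n (brauer_mult n \<gamma> (A 1 2)) = 2 * (t + 1)"
      using step.prems by (intro corank_mult_A[OF \<gamma>]) auto
    moreover have "brauer_mult n \<gamma> (A 1 2) \<in> \<Lambda>"
      using step.prems by (intro \<Lambda>_mult \<gamma> A_in) auto
    ultimately show ?case by auto
  qed
  then show ?thesis using that by blast
qed

lemma target_fixes: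
  assumes "1 \<le> t" "2 * t \<le> n" "i \<in> {1..n}" "j \<in> {1..n}" "i \<noteq> j" "n - 2 * t < j"
    "x \<in> {1..n - 2 * t}" "x \<noteq> i"
  shows "target i j x = x"
  using corank_ex[OF assms(1,2)] target_fixes_aux assms by metis

lemma target_partner:
  assumes "1 \<le> t" "2 * t \<le> n" "i \<in> {1..n - 2 * t}" "j \<in> {n - 2 * t<..n}"
  shows "target i j (partner j) = i"
proof -
  obtain \<gamma> where \<gamma>: "\<gamma> \<in> \<Lambda>" "corank n \<gamma> = 2 * t" using corank_ex[OF assms(1,2)] .
  show ?thesis using assms by (intro target_partner_aux[OF \<gamma>]) auto
qed

text \<open>The two sets are the unions of \<open>B_1\<close>, ..., \<open>B_t\<close> and of
  \<open>B_2\<close>, ..., \<open>B_{t+1}\<close>. In the product of \<gamma> and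
  \<open>A i j\<close>, of corank \<open>2 * (t + 1)\<close>, the right blocks of \<gamma> are
  pushed to right blocks, which lie above \<open>n - 2 * (t + 1)\<close> because every lower right
  pin ends a through block. Counting gives equality.\<close>

lemma target_image:
  assumes ij: "i \<in> {1..n - 2 * t}" "j \<in> {1..n - 2 * t}" "i \<noteq> j"
  shows "target i j ` {n - 2 * t<..n} = {n - 2 * (t + 1)<..n - 2}"
proof (cases "t = 0")
  case False
  then have t: "1 \<le> t" "2 * t \<le> n" using ij by auto
  have ij': "i \<in> {1..n}" "j \<in> {1..n}" "i \<noteq> j" using ij by auto
  obtain \<gamma> where \<gamma>: "\<gamma> \<in> \<Lambda>" "corank n \<gamma> = 2 * t" using corank_ex[OF t] .
  note b = \<Lambda>_brauer[OF \<gamma>(1)] A_brauer[OF ij']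
  let ?\<pi> = "brauer_mult n \<gamma> (A i j)"
  have \<pi>: "?\<pi> \<in> \<Lambda>" "corank n ?\<pi> = 2 * (t + 1)"
    using \<Lambda>_mult \<gamma> A_in[OF ij'] corank_mult_A[OF \<gamma> ij] by auto
  have "target i j x \<in> {n - 2 * (t + 1)<..n - 2}" if x: "x \<in> {n - 2 * t<..n}" for x
  proof -
    have x': "x \<in> {1..n}" "x \<noteq> i" "x \<noteq> j" using x ij by auto
    have xp: "linked \<gamma> (R x) (R (partner x))" using linked_partner[OF \<gamma>] x by simp
    have p: "partner x \<in> {1..n}"
      using linked_pins(2)[OF b(1) xp] by (auto simp: pins_def)
    have np: "partner x \<noteq> c" if c: "c \<in> {1..n - 2 * t}" for c
    proof
      assume "partner x = c"
      moreover obtain a where "linked \<gamma> (L a) (R c)" using through_ex[OF \<gamma> c] .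
      ultimately show False
        using linked_unique[OF b(1), of "R c" "R x" "L a"] xp by (auto simp: insert_commute)
    qed
    have "linked ?\<pi> (R (target i j x)) (R (target i j (partner x)))"
      using linked_mult_push_right[OF b target_linked[OF ij' x'] xp target_linked[OF ij' p]] np ij by blast
    then have "\<not> linked ?\<pi> (R (target i j x)) (L a)" for a
      using linked_unique[OF \<Lambda>_brauer[OF \<pi>(1)]] by blast
    then have "target i j x \<notin> {1..n - 2 * (t + 1)}"
      using through_ex[OF \<pi>, of "target i j x"] by (metis insert_commute)
    moreover have "target i j x \<in> {1..n - 2}"
      using through_le[OF A_in[OF ij'], of 1] A_corank[OF ij'] target_linked[OF ij' x'] by simp
    ultimately show ?thesis by auto
  qed
  moreover have "inj_on (target i j) {n - 2 * t<..n}"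
    by (rule inj_onI) (rule target_inj[OF ij'], use ij in auto)
  then have "card (target i j ` {n - 2 * t<..n}) = 2 * t"
    using t by (simp add: card_image)
  moreover have "2 \<le> n - 2 * t" using ij by auto
  then have "card {n - 2 * (t + 1)<..n - 2} = 2 * t" by simp
  ultimately show ?thesis by (intro card_subset_eq) auto
qed auto

lemma target_le:
  assumes "i \<in> {1..n}" "j \<in> {1..n}" "i \<noteq> j" "x \<in> {1..n} - {i, j}"
  shows "target i j x \<in> {1..n - 2}"
  using through_le[OF A_in[OF assms(1-3)], of 1] A_corank[OF assms(1-3)]
    target_linked[OF assms(1-3), of x] assms(4) by simp

text \<open>Injectivity turns \<open>target_image\<close> into an equivalence, so that two
  consecutive values of \<open>t\<close> isolate a single block.\<close>

lemma target_gt_iff: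
  assumes ij: "i \<in> {1..n - 2 * t}" "j \<in> {1..n - 2 * t}" "i \<noteq> j" and x: "x \<in> {1..n} - {i, j}"
  shows "n - 2 * (t + 1) < target i j x \<longleftrightarrow> n - 2 * t < x"
proof
  have ij': "i \<in> {1..n}" "j \<in> {1..n}" "i \<noteq> j" using ij by auto
  assume "n - 2 * (t + 1) < target i j x"
  then have "target i j x \<in> target i j ` {n - 2 * t<..n}"
    using target_le[OF ij' x] unfolding target_image[OF ij] by simp
  then obtain y where y: "y \<in> {n - 2 * t<..n}" "target i j x = target i j y" by blast
  then have "x = y" using ij by (intro target_inj[OF ij' x]) auto
  then show "n - 2 * t < x" using y by simp
next
  assume "n - 2 * t < x"
  then have "target i j x \<in> target i j ` {n - 2 * t<..n}" using x by auto
  then show "n - 2 * (t + 1) < target i j x" unfolding target_image[OF ij] by simp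
qed

section \<open>Orientations from one block to the next\<close>

definition eps :: "nat \<Rightarrow> nat \<Rightarrow> nat \<Rightarrow> bool" where
  "eps i j m \<longleftrightarrow> target i j (n - 2 * m + 2) = n - 2 * m"

lemma eps_commute: "eps i j m = eps j i m"
  by (simp add: eps_def target_commute)

text \<open>\<open>target_gt_iff\<close> for \<open>m\<close> and \<open>m - 1\<close> confines the
  image of \<open>B_m\<close> to \<open>B_{m+1}\<close>, and injectivity leaves only two bijections.
  \<open>eps\<close> is true for the order-preserving one.\<close>

lemma
  assumes m: "1 \<le> m" and ij: "i \<in> {1..n - 2 * m}" "j \<in> {1..n - 2 * m}" "i \<noteq> j"
  shows target_top: "target i j (n - 2 * m + 2) = (if eps i j m then n - 2 * m else n - 2 * m - 1)"
    and target_bot: "target i j (n - 2 * m + 1) = (if eps i j m then n - 2 * m - 1 else n - 2 * m)"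
proof -
  have ij': "i \<in> {1..n}" "j \<in> {1..n}" "i \<noteq> j" using ij by auto
  have m': "2 * m + 2 \<le> n" using ij by auto
  have *: "target i j x = n - 2 * m - 1 \<or> target i j x = n - 2 * m"
    if "x = n - 2 * m + 1 \<or> x = n - 2 * m + 2" for x
  proof -
    have x: "x \<in> {1..n} - {i, j}" "n - 2 * m < x" "\<not> n - 2 * (m - 1) < x"
      using that m m' ij by auto
    have "n - 2 * (m + 1) < target i j x" using target_gt_iff[OF ij x(1)] x(2) by simp
    moreover have "\<not> n - 2 * (m - 1 + 1) < target i j x"
    proof -
      have "n - 2 * m \<le> n - 2 * (m - 1)" by (rule diff_le_mono2) simp
      then have "i \<in> {1..n - 2 * (m - 1)}" "j \<in> {1..n - 2 * (m - 1)}" using ij by auto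
      then show ?thesis using target_gt_iff[OF _ _ ij(3) x(1)] x(3) by blast
    qed
    ultimately show ?thesis using m m' by auto
  qed
  show top: "target i j (n - 2 * m + 2) = (if eps i j m then n - 2 * m else n - 2 * m - 1)"
    using *[of "n - 2 * m + 2"] by (auto simp: eps_def)
  have "n - 2 * m + 2 \<le> n" using m m' by simp
  then have "target i j (n - 2 * m + 1) \<noteq> target i j (n - 2 * m + 2)"
    using target_inj[OF ij', of "n - 2 * m + 1" "n - 2 * m + 2"] m m' ij by auto
  with top *[of "n - 2 * m + 1"]
  show "target i j (n - 2 * m + 1) = (if eps i j m then n - 2 * m - 1 else n - 2 * m)"
    by (auto split: if_splits)
qed

section \<open>The exchange relation\<close>

lemma A_mult_links:
  assumes d: "distinct [i, j, k, l]" "set [i, j, k, l] \<subseteq> {1..n}"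
  defines "\<pi> \<equiv> brauer_mult n (A i j) (A (target i j k) (target i j l))"
  shows "\<pi> \<in> \<Lambda>" "linked \<pi> (L i) (L j)" "linked \<pi> (L k) (L l)"
    "\<And>x. x \<in> {1..n} \<Longrightarrow> x \<notin> {i, j, k, l} \<Longrightarrow>
      linked \<pi> (L x) (R (target (target i j k) (target i j l) (target i j x)))"
proof -
  have ij: "i \<in> {1..n}" "j \<in> {1..n}" "i \<noteq> j" and kl: "k \<in> {1..n} - {i, j}" "l \<in> {1..n} - {i, j}"
    using d by auto
  have f1: "target i j x \<in> {1..n}" if "x \<in> {1..n} - {i, j}" for x
    using target_le[OF ij that] by auto
  have f2: "target i j x \<noteq> target i j y" if "x \<in> {1..n} - {i, j}" "y \<in> {1..n} - {i, j}" "x \<noteq> y" for x y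
    using target_inj[OF ij that(1,2)] that(3) by blast
  have kl': "target i j k \<in> {1..n}" "target i j l \<in> {1..n}" "target i j k \<noteq> target i j l"
    using f1 f2 kl d by auto
  note b = A_brauer[OF ij] A_brauer[OF kl']
  show "\<pi> \<in> \<Lambda>" unfolding \<pi>_def by (intro \<Lambda>_mult A_in ij kl')
  show "linked \<pi> (L i) (L j)"
    unfolding \<pi>_def by (rule linked_mult_left[OF b A_linked[OF ij]])
  show "linked \<pi> (L k) (L l)" unfolding \<pi>_def
    by (rule linked_mult_pull_left[OF b target_linked[OF ij] A_linked[OF kl'] target_linked[OF ij]]) (use kl in auto)
  show "linked \<pi> (L x) (R (target (target i j k) (target i j l) (target i j x)))"
    if "x \<in> {1..n}" "x \<notin> {i, j, k, l}" for x
    unfolding \<pi>_def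
    by (rule linked_mult_through[OF b target_linked[OF ij] target_linked[OF kl']]) (use kl that f1 f2 in auto)
qed

text \<open>Both products have exactly the left blocks \<open>{i, j}\<close> and
  \<open>{k, l}\<close>, so they are the same element of \<open>\<Lambda>\<close>; its through block
  at \<open>x\<close> is read off in two ways.\<close>

lemma target_f_exchange:
  assumes d: "distinct [i, j, k, l]" "set [i, j, k, l] \<subseteq> {1..n}" and x: "x \<in> {1..n}" "x \<notin> {i, j, k, l}"
  shows "target (target i j k) (target i j l) (target i j x) = target (target k l i) (target k l j) (target k l x)"
proof -
  have d': "distinct [k, l, i, j]" "set [k, l, i, j] \<subseteq> {1..n}" using d by auto
  let ?\<pi> = "brauer_mult n (A i j) (A (target i j k) (target i j l))"
  let ?\<rho> = "brauer_mult n (A k l) (A (target k l i) (target k l j))"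
  note \<pi> = A_mult_links[OF d] and \<rho> = A_mult_links[OF d']
  have "?\<pi> = ?\<rho>"
  proof (rule \<Lambda>_eqI[OF \<pi>(1) \<rho>(1)])
    fix a assume a: "a \<in> {1..n}"
    consider "a = i" | "a = j" | "a = k" | "a = l" | "a \<notin> {i, j, k, l}" by blast
    then show "(\<exists>b. linked ?\<pi> (L a) (L b) \<and> linked ?\<rho> (L a) (L b)) \<or>
      ((\<exists>c. linked ?\<pi> (L a) (R c)) \<and> (\<exists>d. linked ?\<rho> (L a) (R d)))"
    proof cases
      case 5
      then show ?thesis using \<pi>(4)[OF a] \<rho>(4)[OF a] by blast
    qed (use \<pi>(2,3) \<rho>(2,3) linked_sym in blast)+
  qed
  moreover have "x \<notin> {k, l, i, j}" using x by auto
  ultimately show ?thesis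
    using \<pi>(4)[OF x] \<rho>(4)[OF x(1)] linked_unique[OF \<Lambda>_brauer[OF \<rho>(1)]]
    by (metis pin.inject(2))
qed

text \<open>This is \<open>target_f_exchange\<close> at the top pin \<open>n - 2 * m + 2\<close> of
  \<open>B_m\<close>: each side runs from \<open>B_m\<close> over \<open>B_{m+1}\<close> to
  \<open>B_{m+2}\<close> and composes two orientations. Equality of truth values is multiplication
  in the group of order 2, with \<open>True\<close> as identity.\<close>

lemma eps_exchange:
  assumes m: "1 \<le> m" and d: "distinct [i, j, k, l]" and low: "set [i, j, k, l] \<subseteq> {1..n - 2 * m}"
  shows "(eps i j m = eps (target i j k) (target i j l) (m + 1)) = (eps k l m = eps (target k l i) (target k l j) (m + 1))"
proof -
  have *: "(target (target p q r) (target p q s) (target p q (n - 2 * m + 2)) = n - 2 * (m + 1)) =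
      (eps p q m = eps (target p q r) (target p q s) (m + 1))"
    if d: "distinct [p, q, r, s]" and low: "set [p, q, r, s] \<subseteq> {1..n - 2 * m}" for p q r s
  proof -
    have pq: "p \<in> {1..n - 2 * m}" "q \<in> {1..n - 2 * m}" "p \<noteq> q"
      and pq': "p \<in> {1..n}" "q \<in> {1..n}" "p \<noteq> q" using that by auto
    have rs: "r \<in> {1..n} - {p, q}" "s \<in> {1..n} - {p, q}" "r \<noteq> s" using that by auto
    let ?r = "target p q r" and ?s = "target p q s"
    \<comment> \<open>The pins \<open>r\<close> and \<open>s\<close> lie below \<open>B_m\<close>,
      so their images lie below \<open>B_{m+1}\<close>, and the second factor has an orientation at
      level \<open>m + 1\<close>.\<close>
    have r: "?r \<in> {1..n - 2 * (m + 1)}"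
      using target_gt_iff[OF pq rs(1)] target_le[OF pq' rs(1)] low by auto
    moreover have s: "?s \<in> {1..n - 2 * (m + 1)}"
      using target_gt_iff[OF pq rs(2)] target_le[OF pq' rs(2)] low by auto
    moreover have "?r \<noteq> ?s" using target_inj[OF pq' rs(1,2)] rs(3) by blast
    ultimately have "target ?r ?s (n - 2 * (m + 1) + 2) = n - 2 * (m + 1) \<longleftrightarrow> eps ?r ?s (m + 1)"
      "target ?r ?s (n - 2 * (m + 1) + 1) = n - 2 * (m + 1) \<longleftrightarrow> \<not> eps ?r ?s (m + 1)"
      using target_top[of "m + 1" ?r ?s] target_bot[of "m + 1" ?r ?s] by auto
    moreover have "n - 2 * (m + 1) + 2 = n - 2 * m" "n - 2 * (m + 1) + 1 = n - 2 * m - 1"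
      using r by auto
    ultimately show ?thesis using target_top[OF m pq] by auto
  qed
  have x: "n - 2 * m + 2 \<in> {1..n}" "n - 2 * m + 2 \<notin> {i, j, k, l}"
    using m low d by auto
  have "target (target i j k) (target i j l) (target i j (n - 2 * m + 2)) = target (target k l i) (target k l j) (target k l (n - 2 * m + 2))"
    using low by (intro target_f_exchange[OF d _ x]) auto
  moreover have "distinct [k, l, i, j]" "set [k, l, i, j] \<subseteq> {1..n - 2 * m}" using d low by auto
  ultimately show ?thesis using *[OF d low] *[of k l i j] by simp
qed

section \<open>Orientations for pairs that are blocks\<close>

definition block_eps :: "nat \<Rightarrow> nat \<Rightarrow> bool" where
  "block_eps s m = eps (n - 2 * s + 1) (n - 2 * s + 2) m"

text \<open>In \<open>eps_exchange\<close> with \<open>B_s\<close> as second pair, the map for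
  \<open>B_s\<close> fixes \<open>i\<close> and \<open>j\<close>, and the map for
  \<open>{i, j}\<close> moves \<open>B_s\<close> to \<open>B_{s+1}\<close>, possibly swapped, which
  is harmless by \<open>eps_commute\<close>.\<close>

lemma eps_block_exchange:
  assumes m: "1 \<le> m" "m < s" and ij: "i \<in> {1..n - 2 * s}" "j \<in> {1..n - 2 * s}" "i \<noteq> j"
  shows "(eps i j m = block_eps (s + 1) (m + 1)) = (block_eps s m = eps i j (m + 1))"
proof -
  let ?k = "n - 2 * s + 1" and ?l = "n - 2 * s + 2"
  have s: "1 \<le> s" "2 * s + 2 \<le> n" using m ij by auto
  have "target ?k ?l i = i" "target ?k ?l j = j"
    using s ij by (auto intro!: target_fixes[of s])
  moreover have "eps (target i j ?k) (target i j ?l) (m + 1) = block_eps (s + 1) (m + 1)"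
  proof -
    have "n - 2 * s - 1 = n - 2 * (s + 1) + 1" "n - 2 * s = n - 2 * (s + 1) + 2" using s by auto
    then show ?thesis
      using target_top[OF s(1) ij] target_bot[OF s(1) ij] eps_commute by (auto simp: block_eps_def)
  qed
  moreover have "distinct [i, j, ?k, ?l]" "set [i, j, ?k, ?l] \<subseteq> {1..n - 2 * m}"
    using ij m s by auto
  ultimately show ?thesis
    using eps_exchange[OF m(1), of i j ?k ?l] by (simp add: block_eps_def)
qed

text \<open>With \<open>{i, j}\<close> chosen as \<open>B_{s+1}\<close>, the common term
  \<open>block_eps (s + 1) (m + 1)\<close> cancels from \<open>eps_block_exchange\<close>. The
  smallest \<open>s\<close> for which the block lies in \<open>{1..n - 2 * m}\<close> is
  \<open>m + 1\<close>.\<close>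

lemma block_eps_eq:
  assumes m: "1 \<le> m" and "m < s" "2 * s \<le> n"
  shows "block_eps s m = block_eps (m + 1) m"
proof -
  have "m + 1 \<le> s" using assms by simp
  then show ?thesis using assms(3)
  proof (induction s rule: dec_induct)
    case (step s)
    have "(block_eps (s + 1) m = block_eps (s + 1) (m + 1)) = (block_eps s m = block_eps (s + 1) (m + 1))"
      using eps_block_exchange[OF m, of s "n - 2 * (s + 1) + 1" "n - 2 * (s + 1) + 2"] step
      by (auto simp: block_eps_def)
    then show ?case using step by auto
  qed simp
qed

section \<open>The sign of a pair relative to the blocks\<close>

abbreviation block_val :: "nat \<Rightarrow> bool" where
  "block_val m \<equiv> block_eps (m + 1) m"

text \<open>\<open>eps_block_exchange\<close> with \<open>s = m + 1\<close> says that the product of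
  \<open>eps i j\<close> and \<open>block_val\<close> is the same at \<open>m\<close> and
  \<open>m + 1\<close>; this product is the sign of the pair.\<close>

lemma eps_eq_block_val_iff:
  assumes "1 \<le> m" "i \<in> {1..n - 2 * m}" "j \<in> {1..n - 2 * m}" "i \<noteq> j"
  shows "(eps i j m = block_val m) \<longleftrightarrow> (eps i j 1 = block_val 1)"
  using assms
proof (induction m rule: dec_induct)
  case (step m)
  have "(eps i j m = block_val (m + 1)) = (block_val m = eps i j (m + 1))"
    using step.prems eps_block_exchange[OF step.hyps(1), of "m + 1" i j] by simp
  moreover have "(eps i j m = block_val m) \<longleftrightarrow> (eps i j 1 = block_val 1)"
    using step by auto
  ultimately show ?case by auto
qed simp

text \<open>\<open>B_2\<close> consists of \<open>n - 3\<close> and \<open>n - 2\<close>. In the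
  exchange of \<open>{i, n - 3}\<close> with \<open>{k, n - 2}\<close> each map sends the remaining
  pin of \<open>B_2\<close> to the small pin of its own pair, so the second factor is
  \<open>A k i\<close> on both sides and its orientation cancels.\<close>

lemma eps_level_two:
  assumes "i \<in> {1..n - 4}" "k \<in> {1..n - 4}" "i \<noteq> k"
  shows "eps i (n - 3) 1 = eps k (n - 2) 1"
proof -
  have n: "6 \<le> n" using assms by auto
  have p: "partner (n - 3) = n - 2" "partner (n - 2) = n - 3"
    using n by (auto simp: partner_def)
  have "target i (n - 3) (n - 2) = i" "target k (n - 2) (n - 3) = k"
    using target_partner[of 2 i "n - 3"] target_partner[of 2 k "n - 2"] assms n p by auto
  moreover have "target i (n - 3) k = k" "target k (n - 2) i = i"
    using assms n by (auto intro!: target_fixes[of 2])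
  moreover have "distinct [i, n - 3, k, n - 2]" "set [i, n - 3, k, n - 2] \<subseteq> {1..n - 2 * 1}"
    using assms n by auto
  ultimately show ?thesis
    using eps_exchange[of 1 i "n - 3" k "n - 2"] eps_commute[of k i] by auto
qed

text \<open>\<open>eps_level_two\<close> joins \<open>(i, n - 3)\<close> to
  \<open>(k, n - 2)\<close> for \<open>i \<noteq> k\<close>. With the three small pins 1, 2, 3
  available, the resulting bipartite graph is connected.\<close>

lemma eps_level_two_const:
  assumes n: "7 \<le> n" and k: "k \<in> {1..n - 4}" and l: "l = n - 3 \<or> l = n - 2"
  shows "eps k l 1 = eps 1 (n - 3) 1"
proof -
  have 12: "eps 1 (n - 3) 1 = eps 2 (n - 2) 1" "eps 1 (n - 3) 1 = eps 3 (n - 2) 1"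
    "eps 2 (n - 3) 1 = eps 3 (n - 2) 1" "eps 2 (n - 3) 1 = eps 1 (n - 2) 1"
    using n eps_level_two[of 1 2] eps_level_two[of 1 3] eps_level_two[of 2 3] eps_level_two[of 2 1]
    by auto
  have bot: "eps k (n - 3) 1 = eps 1 (n - 3) 1" if "k \<in> {1..n - 4}" for k
  proof (cases "k = 2")
    case False
    then show ?thesis using eps_level_two[of k 2] 12 that n by auto
  qed (use 12 in auto)
  show ?thesis
  proof (cases "k = 1")
    case False
    then show ?thesis using l bot[OF k] eps_level_two[of 1 k] k by auto
  qed (use l 12 in auto)
qed

text \<open>Exchange \<open>B_{s+1}\<close> with \<open>{k, l}\<close> at level 1: the map for
  \<open>B_{s+1}\<close> fixes \<open>k\<close> and sends \<open>l\<close> to \<open>l'\<close>,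
  while the map for \<open>{k, l}\<close> fixes both pins of \<open>B_{s+1}\<close>. Since
  \<open>B_{s+1}\<close> has the orientations \<open>block_val\<close>, the sign of
  \<open>{k, l}\<close> at level 1 is that of \<open>{k, l'}\<close> at level 2, and signs do not
  depend on the level.\<close>

lemma eps_level_down:
  assumes s: "2 \<le> s" and k: "k \<in> {1..n - 2 * (s + 1)}"
    and l': "l' = n - 2 * (s + 1) + 1 \<or> l' = n - 2 * (s + 1) + 2"
  obtains l where "l = n - 2 * s + 1 \<or> l = n - 2 * s + 2" "eps k l' 1 = eps k l 1"
proof -
  let ?i = "n - 2 * (s + 1) + 1" and ?j = "n - 2 * (s + 1) + 2"
  have n: "2 * s + 3 \<le> n" using k by auto
  have ij: "?i \<in> {1..n - 2 * s}" "?j \<in> {1..n - 2 * s}" "?i \<noteq> ?j" using n by auto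
  have "n - 2 * s - 1 = ?i" "n - 2 * s = ?j" using n by auto
  \<comment> \<open>\<open>B_s\<close> is mapped onto \<open>B_{s+1}\<close> in one of two orders,
    so \<open>l'\<close> has a preimage in \<open>B_s\<close>.\<close>
  then obtain l where l: "l = n - 2 * s + 1 \<or> l = n - 2 * s + 2" "target ?i ?j l = l'"
    using target_top[OF _ ij] target_bot[OF _ ij] l' s by (metis one_le_numeral order.trans)
  have "target ?i ?j k = k" using k n by (intro target_fixes[of "s + 1"]) auto
  moreover have "target k l ?i = ?i" "target k l ?j = ?j"
    using k l(1) n s by (auto intro!: target_fixes[of s])
  moreover have "distinct [?i, ?j, k, l]" "set [?i, ?j, k, l] \<subseteq> {1..n - 2 * 1}"
    using k l(1) n s by auto
  ultimately have "(eps ?i ?j 1 = eps k l' 2) = (eps k l 1 = eps ?i ?j 2)"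
    using eps_exchange[of 1 ?i ?j k l] l(2) by (simp only: one_add_one order_refl simp_thms)
  moreover have "eps ?i ?j 1 = block_val 1" "eps ?i ?j 2 = block_val 2"
    using block_eps_eq[of 1 "s + 1"] block_eps_eq[of 2 "s + 1"] n s by (auto simp: block_eps_def)
  moreover have "(eps k l' 2 = block_val 2) \<longleftrightarrow> (eps k l' 1 = block_val 1)"
    using eps_eq_block_val_iff[of 2 k l'] k l' n s by auto
  ultimately have "eps k l' 1 = eps k l 1" by auto
  with l(1) show ?thesis using that by blast
qed

text \<open>A pair in \<open>{1..n - 2}\<close> that is no block has its larger pin in some
  \<open>B_s\<close> and its smaller pin below \<open>B_s\<close>; \<open>eps_level_down\<close>
  moves the larger pin step by step to \<open>B_2\<close>.\<close>

lemma eps_off_block_const: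
  assumes n: "7 \<le> n" and "2 \<le> s" "k \<in> {1..n - 2 * s}" "l = n - 2 * s + 1 \<or> l = n - 2 * s + 2"
  shows "eps k l 1 = eps 1 (n - 3) 1"
  using assms(2-)
proof (induction s arbitrary: l rule: dec_induct)
  case base
  then show ?case using n by (intro eps_level_two_const) auto
next
  case (step s)
  then obtain l' where "l' = n - 2 * s + 1 \<or> l' = n - 2 * s + 2" "eps k l 1 = eps k l' 1"
    using eps_level_down[of s k l] by auto
  then show ?case using step by auto
qed

section \<open>Back to the permutations \<open>alpha_perm\<close>\<close>

lemma alpha_perm_eq:
  assumes "1 \<le> l" "i \<in> {1..n - 2 * l}" "j \<in> {1..n - 2 * l}" "i \<noteq> j"
  shows "alpha_perm n \<Lambda> i j l = (if eps i j l then id else transpose 1 2)"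
proof -
  have ij: "i \<in> {1..n}" "j \<in> {1..n}" "i \<noteq> j" using assms by auto
  have x: "n - 2 * l + 2 \<in> {1..n}" "n - 2 * l + 2 \<noteq> i" "n - 2 * l + 2 \<noteq> j" using assms by auto
  have "linked (A i j) (L (n - 2 * l + 2)) (R y) \<longleftrightarrow> target i j (n - 2 * l + 2) = y" for y
    using target_linked[OF ij x] target_eqI[OF ij] by blast
  then show ?thesis using target_top[OF assms] assms by (auto simp: alpha_perm_def)
qed

lemma alpha_perm_A:
  assumes "(i, j) \<in> A_pairs n" "1 \<le> i" "1 \<le> l" "l \<le> (n - j) div 2"
  shows "alpha_perm n \<Lambda> i j l = (if block_val l then id else transpose 1 2)"
proof -
  \<comment> \<open>A pair in \<open>A_pairs n\<close> is a block \<open>B_{m+1}\<close> with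
    \<open>m \<ge> 1\<close>; the bound on \<open>l\<close> means \<open>l \<le> m\<close>.\<close>
  obtain m where m: "i = n - 2 * m - 1" "j = n - 2 * m" "1 \<le> m" "2 * m + 1 < n"
    using assms(1) by (auto simp: A_pairs_def)
  then have "l < m + 1" "n - 2 * (m + 1) + 1 = i" "n - 2 * (m + 1) + 2 = j" using assms by auto
  then have "eps i j l = block_val l"
    using block_eps_eq[of l "m + 1"] assms(3) m by (simp add: block_eps_def)
  moreover have "n - 2 * m \<le> n - 2 * l" using assms m by (intro diff_le_mono2) auto
  then have "i \<in> {1..n - 2 * l}" "j \<in> {1..n - 2 * l}" "i \<noteq> j" using assms(2) m by auto
  ultimately show ?thesis using alpha_perm_eq assms(3) by simp
qed

text \<open>The sign, equal for all pairs that are no blocks, is read off from the pair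
  \<open>{1, n - 3}\<close> at level 1.\<close>

lemma alpha_perm_not_A:
  assumes n: "7 \<le> n" and ij: "(i, j) \<notin> A_pairs n" "1 \<le> i" "i < j" "j \<le> n - 2"
    and l: "1 \<le> l" "l \<le> (n - j) div 2"
  shows "alpha_perm n \<Lambda> i j l =
    (if block_val l = (eps 1 (n - 3) 1 = block_val 1) then id else transpose 1 2)"
proof -
  \<comment> \<open>\<open>B_s\<close> contains \<open>j\<close>, and \<open>j \<le> n - 2\<close>
    excludes \<open>s = 1\<close>.\<close>
  define s where "s = (n - j) div 2 + 1"
  have s: "2 \<le> s" "2 * s + j \<le> n + 2" "j = n - 2 * s + 1 \<or> j = n - 2 * s + 2"
    using ij n unfolding s_def by presburger+
  \<comment> \<open>Otherwise \<open>{i, j}\<close> would be \<open>B_s\<close>, the member of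
    \<open>A_pairs n\<close> with index \<open>m = s - 1\<close>.\<close>
  have "\<not> n - 2 * s < i"
  proof
    assume "n - 2 * s < i"
    moreover obtain m where "s = m + 1" "1 \<le> m" using s(1) by (intro that[of "s - 1"]) auto
    ultimately have "i = n - 2 * m - 1" "j = n - 2 * m" "1 \<le> m" "2 * m + 1 < n"
      using s(2,3) ij by auto
    then show False using ij(1) unfolding A_pairs_def by blast
  qed
  then have "eps i j 1 = eps 1 (n - 3) 1"
    using s ij by (intro eps_off_block_const[OF n s(1)]) auto
  moreover have low: "i \<in> {1..n - 2 * l}" "j \<in> {1..n - 2 * l}" "i \<noteq> j" using ij l by auto
  ultimately show ?thesis
    using alpha_perm_eq[OF l(1) low] eps_eq_block_val_iff[OF l(1) low] by auto
qed

text \<open>Permutations of pairs outside \<open>A_pairs n\<close> differ from those of blocks by a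
  factor independent of \<open>l\<close>, and in a commutative group this factor may move from one
  level to the other.\<close>

lemma alpha_perm_exchange:
  assumes n: "7 \<le> n" and p: "(i, j) \<in> A_pairs n" "1 \<le> i"
    and q: "(k, k') \<notin> A_pairs n" "1 \<le> k" "k < k'" "k' \<le> n - 2"
    and l: "1 \<le> l" "l + 1 \<le> (n - j) div 2" "l + 1 \<le> (n - k') div 2"
  shows "alpha_perm n \<Lambda> i j l \<circ> alpha_perm n \<Lambda> k k' (l + 1) =
    alpha_perm n \<Lambda> k k' l \<circ> alpha_perm n \<Lambda> i j (l + 1)"
  using l by (simp add: alpha_perm_A[OF p] alpha_perm_not_A[OF n q] del: One_nat_def)

end

theorem proposition11:
  fixes n :: nat and \<Lambda> :: "pin set set set"
  assumes "R_cross_section n \<Lambda>" and "canonical n \<Lambda>"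
  shows
    "(even n \<and> n \<ge> 8 \<longrightarrow>
       (\<forall>i j. 1 \<le> i \<and> i < j \<and> j \<le> n - 2 \<and> (i, j) \<in> A_pairs n \<longrightarrow>
          (\<forall>l\<in>{1..(n - j) div 2}. alpha_perm n \<Lambda> 1 2 l = alpha_perm n \<Lambda> i j l)) \<and>
       (\<forall>i j. 1 \<le> i \<and> i < j \<and> j \<le> n - 2 \<and> (i, j) \<notin> A_pairs n \<longrightarrow>
          (\<forall>l\<in>{1..(n - j) div 2}. alpha_perm n \<Lambda> 2 3 l = alpha_perm n \<Lambda> i j l)) \<and>
       (\<forall>l\<in>{1..n div 2 - 3}.
          alpha_perm n \<Lambda> 1 2 l \<circ> alpha_perm n \<Lambda> 2 3 (l + 1) =
          alpha_perm n \<Lambda> 2 3 l \<circ> alpha_perm n \<Lambda> 1 2 (l + 1)))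
     \<and>
     (odd n \<and> n \<ge> 7 \<longrightarrow>
       (\<forall>i j. 1 \<le> i \<and> i < j \<and> j \<le> n - 2 \<and> (i, j) \<in> A_pairs n \<longrightarrow>
          (\<forall>l\<in>{1..(n - j) div 2}. alpha_perm n \<Lambda> 2 3 l = alpha_perm n \<Lambda> i j l)) \<and>
       (\<forall>i j. 1 \<le> i \<and> i < j \<and> j \<le> n - 2 \<and> (i, j) \<notin> A_pairs n \<longrightarrow>
          (\<forall>l\<in>{1..(n - j) div 2}. alpha_perm n \<Lambda> 1 2 l = alpha_perm n \<Lambda> i j l)) \<and>
       (\<forall>l\<in>{1..(n + 1) div 2 - 3}.
          alpha_perm n \<Lambda> 1 2 l \<circ> alpha_perm n \<Lambda> 2 3 (l + 1) =
          alpha_perm n \<Lambda> 2 3 l \<circ> alpha_perm n \<Lambda> 1 2 (l + 1)))"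
proof -
  interpret canonical_cross_section n \<Lambda> using assms by unfold_locales
  \<comment> \<open>Parity decides which neighbours form a block: \<open>{1, 2}\<close> does for
    even \<open>n\<close> and \<open>{2, 3}\<close> for odd \<open>n\<close>, so in either case one
    of the two pairs represents each kind.\<close>
  have A: "(i, i + 1) \<in> A_pairs n \<longleftrightarrow> even (n - i - 1)" if "1 \<le> i" "i + 3 \<le> n" for i
  proof
    assume "even (n - i - 1)"
    then obtain m where "n - i - 1 = 2 * m" by (elim evenE)
    then show "(i, i + 1) \<in> A_pairs n" using that unfolding A_pairs_def by (auto intro!: exI[of _ m])
  qed (auto simp: A_pairs_def)
  show ?thesis
  proof (rule conjI; rule impI; elim conjE)
    assume n: "even n" "8 \<le> n"
    have p: "(1, 2) \<in> A_pairs n" using A[of 1, unfolded one_add_one] n by simp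
    have q: "(2, 3) \<notin> A_pairs n" using A[of 2] n by simp
    show "(\<forall>i j. 1 \<le> i \<and> i < j \<and> j \<le> n - 2 \<and> (i, j) \<in> A_pairs n \<longrightarrow>
          (\<forall>l\<in>{1..(n - j) div 2}. alpha_perm n \<Lambda> 1 2 l = alpha_perm n \<Lambda> i j l)) \<and>
       (\<forall>i j. 1 \<le> i \<and> i < j \<and> j \<le> n - 2 \<and> (i, j) \<notin> A_pairs n \<longrightarrow>
          (\<forall>l\<in>{1..(n - j) div 2}. alpha_perm n \<Lambda> 2 3 l = alpha_perm n \<Lambda> i j l)) \<and>
       (\<forall>l\<in>{1..n div 2 - 3}.
          alpha_perm n \<Lambda> 1 2 l \<circ> alpha_perm n \<Lambda> 2 3 (l + 1) =
          alpha_perm n \<Lambda> 2 3 l \<circ> alpha_perm n \<Lambda> 1 2 (l + 1))"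
    proof (intro conjI allI impI ballI; (elim conjE)?)
      fix i j l assume *: "1 \<le> i" "i < j" "j \<le> n - 2" and l: "l \<in> {1..(n - j) div 2}"
      show "alpha_perm n \<Lambda> 1 2 l = alpha_perm n \<Lambda> i j l" if "(i, j) \<in> A_pairs n"
      proof -
        have "l \<le> (n - 2) div 2" using * l by auto
        then show ?thesis
          using * l by (simp add: alpha_perm_A[OF p] alpha_perm_A[OF that] del: One_nat_def)
      qed
      show "alpha_perm n \<Lambda> 2 3 l = alpha_perm n \<Lambda> i j l" if "(i, j) \<notin> A_pairs n"
      proof -
        \<comment> \<open>The bound needs \<open>j \<ge> 3\<close>; only \<open>(1, 2)\<close> has
          \<open>j = 2\<close>, and for even \<open>n\<close> that pair is a block.\<close>
        have "l \<le> (n - 3) div 2"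
        proof (cases "j = 2")
          case True
          then have "i = 1" using * by simp
          then show ?thesis using True p that by simp
        qed (use * l in auto)
        then show ?thesis using * l n by (simp add: alpha_perm_not_A[OF _ q] alpha_perm_not_A[OF _ that])
      qed
    next
      fix l assume "l \<in> {1..n div 2 - 3}"
      then show "alpha_perm n \<Lambda> 1 2 l \<circ> alpha_perm n \<Lambda> 2 3 (l + 1) =
          alpha_perm n \<Lambda> 2 3 l \<circ> alpha_perm n \<Lambda> 1 2 (l + 1)"
        using n by (intro alpha_perm_exchange[OF _ p _ q]) auto
    qed
  next
    assume n: "odd n" "7 \<le> n"
    have p: "(2, 3) \<in> A_pairs n" using A[of 2] n by simp
    have q: "(1, 2) \<notin> A_pairs n" using A[of 1, unfolded one_add_one] n by simp
    show "(\<forall>i j. 1 \<le> i \<and> i < j \<and> j \<le> n - 2 \<and> (i, j) \<in> A_pairs n \<longrightarrow>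
          (\<forall>l\<in>{1..(n - j) div 2}. alpha_perm n \<Lambda> 2 3 l = alpha_perm n \<Lambda> i j l)) \<and>
       (\<forall>i j. 1 \<le> i \<and> i < j \<and> j \<le> n - 2 \<and> (i, j) \<notin> A_pairs n \<longrightarrow>
          (\<forall>l\<in>{1..(n - j) div 2}. alpha_perm n \<Lambda> 1 2 l = alpha_perm n \<Lambda> i j l)) \<and>
       (\<forall>l\<in>{1..(n + 1) div 2 - 3}.
          alpha_perm n \<Lambda> 1 2 l \<circ> alpha_perm n \<Lambda> 2 3 (l + 1) =
          alpha_perm n \<Lambda> 2 3 l \<circ> alpha_perm n \<Lambda> 1 2 (l + 1))"
    proof (intro conjI allI impI ballI; (elim conjE)?)
      fix i j l assume *: "1 \<le> i" "i < j" "j \<le> n - 2" and l: "l \<in> {1..(n - j) div 2}"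
      show "alpha_perm n \<Lambda> 2 3 l = alpha_perm n \<Lambda> i j l" if "(i, j) \<in> A_pairs n"
      proof -
        \<comment> \<open>Again \<open>j \<ge> 3\<close>, now because \<open>(1, 2)\<close> is no
          block for odd \<open>n\<close>.\<close>
        have "l \<le> (n - 3) div 2"
        proof (cases "j = 2")
          case True
          then have "i = 1" using * by simp
          then show ?thesis using True q that by simp
        qed (use * l in auto)
        then show ?thesis using * l by (simp add: alpha_perm_A[OF p] alpha_perm_A[OF that])
      qed
      show "alpha_perm n \<Lambda> 1 2 l = alpha_perm n \<Lambda> i j l" if "(i, j) \<notin> A_pairs n"
      proof -
        have "l \<le> (n - 2) div 2" using * l by auto
        then show ?thesis using * l n
          by (simp add: alpha_perm_not_A[OF _ q] alpha_perm_not_A[OF _ that] del: One_nat_def)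
      qed
    next
      fix l assume "l \<in> {1..(n + 1) div 2 - 3}"
      then have "1 \<le> l" "l + 1 \<le> (n - 3) div 2" "l + 1 \<le> (n - 2) div 2"
        using n unfolding atLeastAtMost_iff by presburger+
      then show "alpha_perm n \<Lambda> 1 2 l \<circ> alpha_perm n \<Lambda> 2 3 (l + 1) =
          alpha_perm n \<Lambda> 2 3 l \<circ> alpha_perm n \<Lambda> 1 2 (l + 1)"
        \<comment> \<open>The block is now \<open>{2, 3}\<close>, so the relation is needed with its
          sides interchanged.\<close>
        using n by (intro alpha_perm_exchange[OF _ p _ q, symmetric]) auto
    qed
  qed
qed

end
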